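(* Let $\tau>-1$ be a real number and let $n\in\mathbb{N}_0$. Then the Reiswich polynomial $R^\tau_n$ is, up to normalization, a Jacobi polynomial after a linear change of variables: there exists a nonzero real constant $c$ (depending on $n$ and $\tau$) such that $$ R^\tau_n(x)\;=\;c\,P^{(1,\tau)}_n(2x-1) $$ as polynomials in $x$.
   Context: For $r\in\mathbb{N}_0$ the falling factorial is $[\![\,z\,]\!]_r:=z(z-1)\cdots(z-r+1)$, with $[\![\,z\,]\!]_0:=1$. For $n\in\mathbb{N}_0$ and real $\tau>-1$ the Reiswich polynomial $R^\tau_n\in\mathbb{R}[x]$ is $$ R^\tau_n(x):=\sum_{r=0}^n(-1)^r\binom{n}{r}\frac{[\![\,n+\tau\,]\!]_r}{[\![\,2n+\tau+1\,]\!]_r}\,x^{n-r}. $$ For real $\alpha,\beta>-1$, $P^{(\alpha,\beta)}_n$ denotes the classical Jacobi polynomial of degree $n$; the sequence $(P^{(\alpha,\beta)}_n)_{n\in\mathbb{N}_0}$ is orthogonal on $[-1,1]$ with respect to the weight $(1-t)^\alpha(1+t)^\beta\,dt$, and explicitly $$ P^{(\alpha,\beta)}_n(t)=\sum_{s=0}^n\binom{n+\alpha}{n-s}\binom{n+\beta}{s}\Big(\frac{t-1}{2}\Big)^s\Big(\frac{t+1}{2}\Big)^{n-s}, $$ where $\binom{z}{s}:=[\![\,z\,]\!]_s/s!$ for real $z$ and $s\in\mathbb{N}_0$. *)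

theory Defs
  imports Complex_Main "HOL-Computational_Algebra.Polynomial"
begin

definition falling_factorial :: "real \<Rightarrow> nat \<Rightarrow> real" where
  "falling_factorial z r = (\<Prod>i<r. z - real i)"

lemma gbinomial_falling_factorial:
  fixes z :: real
  shows "z gchoose s = falling_factorial z s / fact s"
  by (simp add: falling_factorial_def gbinomial_prod_rev atLeast0LessThan)

text \<open>For \<open>\<tau> > -1\<close> the denominators are nonzero: every factor of
  \<open>falling_factorial (2 * n + \<tau> + 1) r\<close> with \<open>r \<le> n\<close> is at least \<open>n + \<tau> + 2\<close>.\<close>

definition reiswich_poly :: "real \<Rightarrow> nat \<Rightarrow> real poly" where
  "reiswich_poly \<tau> n =
    (\<Sum>r\<le>n. monom ((- 1) ^ r * real (n choose r) *
        (falling_factorial (real n + \<tau>) r / falling_factorial (2 * real n + \<tau> + 1) r)) (n - r))"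

text \<open>The factors \<open>[:- 1 / 2, 1 / 2:]\<close> and \<open>[:1 / 2, 1 / 2:]\<close> are the
  polynomials \<open>(t - 1) / 2\<close> and \<open>(t + 1) / 2\<close>.\<close>

definition jacobi_poly :: "real \<Rightarrow> real \<Rightarrow> nat \<Rightarrow> real poly" where
  "jacobi_poly \<alpha> \<beta> n =
    (\<Sum>s\<le>n. smult (((real n + \<alpha>) gchoose (n - s)) * ((real n + \<beta>) gchoose s))
        ([:- 1 / 2, 1 / 2:] ^ s * [:1 / 2, 1 / 2:] ^ (n - s)))"

end

(* Expanding (x - 1)^s in the shifted Jacobi polynomial and summing the coefficients of
   x^(n - r) by Chu-Vandermonde gives (-1)^r ((n + \<beta>) gchoose r) ((2 n + \<alpha> + \<beta> - r) gchoose (n - r)).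
   With N = 2 n + \<alpha> + \<beta>, trinomial revision turns the last factor into
   (N gchoose n) (n choose r) / (N gchoose r).  For \<alpha> = 1 this is the Reiswich coefficient
   times the constant N gchoose n. *)

theory Submission
  imports Defs "HOL-Computational_Algebra.Formal_Power_Series"
begin

text \<open>The binomial theorem gives a sum over \<open>r \<le> s\<close>; as
  \<open>s choose r\<close> vanishes for \<open>r > s\<close>, it extends to
  \<open>r \<le> n\<close>. A range independent of \<open>s\<close> allows the later interchange of
  sums.\<close>

lemma power_diff_one_times_power:
  fixes x :: real
  assumes "s \<le> n"
  shows "(x - 1) ^ s * x ^ (n - s) = (\<Sum>r\<le>n. (-1) ^ r * real (s choose r) * x ^ (n - r))"
proof -
  have "(x - 1) ^ s = (\<Sum>r\<le>s. real (s choose r) * (-1) ^ r * x ^ (s - r))"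
    using binomial_ring[of "-1" x s] by simp
  then have "(x - 1) ^ s * x ^ (n - s) =
      (\<Sum>r\<le>s. (-1) ^ r * real (s choose r) * (x ^ (s - r) * x ^ (n - s)))"
    by (simp add: sum_distrib_left mult_ac)
  also have "\<dots> = (\<Sum>r\<le>s. (-1) ^ r * real (s choose r) * x ^ (n - r))"
    using assms by (intro sum.cong) (simp_all flip: power_add)
  also have "\<dots> = (\<Sum>r\<le>n. (-1) ^ r * real (s choose r) * x ^ (n - r))"
    using assms by (intro sum.mono_neutral_left) auto
  finally show ?thesis .
qed

text \<open>Terms with \<open>s < r\<close> vanish. In the others, trinomial revision pulls out
  \<open>b gchoose r\<close>, and the shift \<open>k = s - r\<close> leaves a Vandermonde
  convolution with upper arguments \<open>b - r\<close> and \<open>a\<close>.\<close>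

lemma gbinomial_Vandermonde_trinomial:
  fixes a b :: real
  assumes "r \<le> n"
  shows "(\<Sum>s\<le>n. (a gchoose (n - s)) * (b gchoose s) * real (s choose r)) =
    (b gchoose r) * ((a + b - real r) gchoose (n - r))"
proof -
  have "(\<Sum>s\<le>n. (a gchoose (n - s)) * (b gchoose s) * real (s choose r)) =
      (\<Sum>s=r..n. (a gchoose (n - s)) * (b gchoose s) * real (s choose r))"
    by (intro sum.mono_neutral_right) auto
  also have "\<dots> = (\<Sum>s=r..n. (b gchoose r) *
      (((b - real r) gchoose (s - r)) * (a gchoose (n - s))))"
  proof (rule sum.cong)
    fix s assume "s \<in> {r..n}"
    then have "(b gchoose s) * real (s choose r) = (b gchoose r) * ((b - real r) gchoose (s - r))"
      using gbinomial_trinomial_revision[of r s b] by (simp add: binomial_gbinomial)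
    then show "(a gchoose (n - s)) * (b gchoose s) * real (s choose r) =
        (b gchoose r) * (((b - real r) gchoose (s - r)) * (a gchoose (n - s)))"
      by (simp add: mult_ac)
  qed simp
  also have "\<dots> = (\<Sum>k\<le>n - r. (b gchoose r) *
      (((b - real r) gchoose k) * (a gchoose (n - r - k))))"
    using assms
    by (intro sum.reindex_bij_witness[of _ "\<lambda>k. k + r" "\<lambda>s. s - r"]) auto
  also have "\<dots> = (b gchoose r) * ((a + b - real r) gchoose (n - r))"
    using gbinomial_Vandermonde[of "b - real r" a "n - r"]
    by (simp add: atMost_atLeast0 algebra_simps flip: sum_distrib_left)
  finally show ?thesis .
qed

lemma poly_jacobi_poly_shifted:
  "poly (jacobi_poly \<alpha> \<beta> n) (2 * x - 1) =
    (\<Sum>r\<le>n. (-1) ^ r * ((real n + \<beta>) gchoose r) *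
      ((2 * real n + \<alpha> + \<beta> - real r) gchoose (n - r)) * x ^ (n - r))"
proof -
  let ?A = "\<lambda>s. ((real n + \<alpha>) gchoose (n - s)) * ((real n + \<beta>) gchoose s)"
  have add: "real n + \<alpha> + (real n + \<beta>) = 2 * real n + \<alpha> + \<beta>"
    by simp
  \<comment> \<open>These are the two linear factors of \<open>jacobi_poly\<close>, evaluated at
    \<open>2 * x - 1\<close>.\<close>
  have affine: "(2 * x - 1) / 2 - 1 / 2 = x - 1" "1 / 2 + (2 * x - 1) / 2 = x"
    by (simp_all add: field_simps)
  have "poly (jacobi_poly \<alpha> \<beta> n) (2 * x - 1) = (\<Sum>s\<le>n. ?A s * ((x - 1) ^ s * x ^ (n - s)))"
    by (simp add: jacobi_poly_def poly_sum affine)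
  also have "\<dots> = (\<Sum>s\<le>n. \<Sum>r\<le>n. (-1) ^ r * (?A s * real (s choose r)) * x ^ (n - r))"
    by (intro sum.cong)
      (simp_all add: power_diff_one_times_power sum_distrib_left mult.assoc mult.left_commute)
  \<comment> \<open>The power \<open>x ^ (n - r)\<close> is free of \<open>s\<close>, so after the
    swap the inner sum is purely a coefficient.\<close>
  also have "\<dots> = (\<Sum>r\<le>n. (-1) ^ r * (\<Sum>s\<le>n. ?A s * real (s choose r)) * x ^ (n - r))"
    by (subst sum.swap) (simp add: sum_distrib_left sum_distrib_right)
  also have "\<dots> = (\<Sum>r\<le>n. (-1) ^ r * ((real n + \<beta>) gchoose r) *
      ((2 * real n + \<alpha> + \<beta> - real r) gchoose (n - r)) * x ^ (n - r))"
    by (intro sum.cong refl, subst gbinomial_Vandermonde_trinomial) (simp_all add: add)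
  finally show ?thesis .
qed

text \<open>Each factor \<open>z - i\<close> of the numerator is positive, since
  \<open>i < r\<close> gives \<open>i \<le> r - 1 < z\<close>.\<close>

lemma gbinomial_pos_of_nat_less:
  fixes z :: real
  assumes "real r < z + 1"
  shows "z gchoose r > 0"
  using assms by (auto simp: gbinomial_prod_rev intro!: divide_pos_pos prod_pos)

theorem mainTheorem2:
  fixes \<tau> :: real and n :: nat
  assumes "\<tau> > -1"
  shows "\<exists>c::real. c \<noteq> 0 \<and>
    reiswich_poly \<tau> n = smult c (pcompose (jacobi_poly 1 \<tau> n) [:-1, 2:])"
proof -
  define N where "N = 2 * real n + \<tau> + 1"
  \<comment> \<open>From \<open>\<tau> > -1\<close> follows \<open>N + 1 > 2 * n + 1 > r\<close>.
    Positivity justifies dividing by \<open>N gchoose r\<close> and makes the constant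
    \<open>1 / (N gchoose n)\<close> nonzero.\<close>
  have pos: "N gchoose r > 0" if "r \<le> n" for r
    using that assms by (intro gbinomial_pos_of_nat_less) (simp add: N_def)
  have coeff: "real (n choose r) *
      (falling_factorial (real n + \<tau>) r / falling_factorial N r) =
      1 / (N gchoose n) * (((real n + \<tau>) gchoose r) * ((N - real r) gchoose (n - r)))"
    if "r \<le> n" for r
  proof -
    \<comment> \<open>The common factor \<open>fact r\<close> cancels in the quotient.\<close>
    have "falling_factorial (real n + \<tau>) r / falling_factorial N r =
        ((real n + \<tau>) gchoose r) / (N gchoose r)"
      by (simp add: gbinomial_falling_factorial)
    moreover have "(N gchoose n) * real (n choose r) = (N gchoose r) * ((N - real r) gchoose (n - r))"
      using gbinomial_trinomial_revision[OF that, of N] by (simp add: binomial_gbinomial)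
    ultimately show ?thesis
      using pos[OF that] pos[of n]
      by (simp only: times_divide_eq_right) (simp add: field_simps)
  qed
  \<comment> \<open>Real polynomials that agree at every point are equal, so it suffices to
    evaluate; the composition then becomes the substitution \<open>2 * x - 1\<close>.\<close>
  have "poly (reiswich_poly \<tau> n) x =
      poly (smult (1 / (N gchoose n)) (pcompose (jacobi_poly 1 \<tau> n) [:-1, 2:])) x" for x
  proof -
    have "poly (reiswich_poly \<tau> n) x = (\<Sum>r\<le>n. (-1) ^ r * (real (n choose r) *
        (falling_factorial (real n + \<tau>) r / falling_factorial N r)) * x ^ (n - r))"
      by (simp add: reiswich_poly_def poly_sum poly_monom N_def mult_ac)
    also have "\<dots> = (\<Sum>r\<le>n. 1 / (N gchoose n) * ((-1) ^ r * ((real n + \<tau>) gchoose r) *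
        ((N - real r) gchoose (n - r)) * x ^ (n - r)))"
      by (intro sum.cong refl, subst coeff) simp_all
    also have "\<dots> = 1 / (N gchoose n) * poly (jacobi_poly 1 \<tau> n) (2 * x - 1)"
      unfolding poly_jacobi_poly_shifted sum_distrib_left
      by (simp add: N_def add_ac)
    finally show ?thesis
      by (simp add: poly_pcompose algebra_simps)
  qed
  then have "reiswich_poly \<tau> n =
      smult (1 / (N gchoose n)) (pcompose (jacobi_poly 1 \<tau> n) [:-1, 2:])"
    by (simp add: poly_eq_poly_eq_iff[symmetric] fun_eq_iff)
  moreover have "1 / (N gchoose n) \<noteq> 0"
    using pos[of n] by simp
  ultimately show ?thesis
    by blast
qed

end
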